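(* Let $p,q\ge0$ be integers, and let $a_1,a_2,b_1,b_2>0$ be real numbers. Let $\alpha_a=(\alpha_1,\alpha_2):I\to\mathbb{C}^2$ be the solution, on an open interval $I\ni 0$, of $$\alpha_j'\,\bar\alpha_j=i\,\bar\alpha_1^{\,p+1}\bar\alpha_2^{\,q+1},\quad j=1,2,\qquad \alpha_a(0)=(a_1,a_2),$$ and let $\gamma_b=(\gamma_1,\gamma_2):I'\to\mathbb{C}^2$ be the solution, on an open interval $I'\ni0$, of $$\gamma_j'\,\bar\gamma_j=(-1)^{j-1}\,i\,\bar\gamma_1^{\,p+1}\bar\gamma_2^{\,q+1},\quad j=1,2,\qquad \gamma_b(0)=(b_1,b_2).$$ Then the map $\phi:I\times I'\to\mathbb{C}^2$, $$\phi(t,s)=(\alpha_1(t)\gamma_1(s),\alpha_2(t)\gamma_2(s)),$$ is a Lagrangian immersion satisfying $\beta_\phi+p\,\arg\phi_1+q\,\arg\phi_2=0$ in $\mathbb{R}/2\pi\mathbb{Z}$, where $I\times I'\subset\mathbb{R}^2$ has the orientation given by the coordinates $(t,s)$.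
   Context: On $\mathbb{C}^2$ let $(z,w)=\sum_i z_i\bar w_i$, with Euclidean metric $\Re(\cdot,\cdot)$ and Kähler form $\omega=-\Im(\cdot,\cdot)$. An immersion $\phi$ of a surface into $\mathbb{C}^2$ is Lagrangian if $\phi^*\omega=0$. For an oriented surface, the Lagrangian angle map $\beta_\phi$ with values in $\mathbb{R}/2\pi\mathbb{Z}$ is defined by $e^{i\beta_\phi}=(dz_1\wedge dz_2)(\phi_*e_1,\phi_*e_2)$ for any oriented basis $e_1,e_2$ that is orthonormal for the induced metric. For $\phi=(\phi_1,\phi_2)$, $\arg\phi_j\in\mathbb{R}/2\pi\mathbb{Z}$ denotes the argument of the nonzero complex number $\phi_j$. *)

theory Defs
  imports "HOL-Analysis.Analysis" "HOL-Library.Real_Mod"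
begin

definition herm :: "complex ^ 2 \<Rightarrow> complex ^ 2 \<Rightarrow> complex" where
  "herm z w = (\<Sum>i\<in>UNIV. z $ i * cnj (w $ i))"

definition metric :: "complex ^ 2 \<Rightarrow> complex ^ 2 \<Rightarrow> real" where
  "metric z w = Re (herm z w)"

definition kaehler_form :: "complex ^ 2 \<Rightarrow> complex ^ 2 \<Rightarrow> real" where
  "kaehler_form z w = - Im (herm z w)"

definition dz1_wedge_dz2 :: "complex ^ 2 \<Rightarrow> complex ^ 2 \<Rightarrow> complex" where
  "dz1_wedge_dz2 u v = u $ 1 * v $ 2 - u $ 2 * v $ 1"

text \<open>Surfaces occur only as open subsets of the plane, so an immersion is a map on such a set.
  The notions below are meant for open sets, where the Frechet derivative is unique.
  \<open>Ck_on k f S\<close> is the class of \<open>k\<close> times continuously differentiable maps, by recursion over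
  the directional derivatives.\<close>

primrec Ck_on ::
  "nat \<Rightarrow> ('a::euclidean_space \<Rightarrow> 'b::real_normed_vector) \<Rightarrow> 'a set \<Rightarrow> bool" where
  "Ck_on 0 f S \<longleftrightarrow> continuous_on S f"
| "Ck_on (Suc k) f S \<longleftrightarrow>
     (\<forall>x\<in>S. f differentiable (at x)) \<and>
     (\<forall>v. Ck_on k (\<lambda>x. frechet_derivative f (at x) v) S)"

definition smooth_on ::
  "('a::euclidean_space \<Rightarrow> 'b::real_normed_vector) \<Rightarrow> 'a set \<Rightarrow> bool" where
  "smooth_on f S \<longleftrightarrow> (\<forall>k. Ck_on k f S)"

definition immersion_on ::
  "('a::euclidean_space \<Rightarrow> 'b::real_normed_vector) \<Rightarrow> 'a set \<Rightarrow> bool" where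
  "immersion_on f S \<longleftrightarrow>
     smooth_on f S \<and> (\<forall>x\<in>S. inj (frechet_derivative f (at x)))"

definition lagrangian_immersion_on ::
  "(real \<times> real \<Rightarrow> complex ^ 2) \<Rightarrow> (real \<times> real) set \<Rightarrow> bool" where
  "lagrangian_immersion_on f S \<longleftrightarrow>
     immersion_on f S \<and>
     (\<forall>x\<in>S. \<forall>u v. kaehler_form (frechet_derivative f (at x) u) (frechet_derivative f (at x) v) = 0)"

text \<open>Bases of the tangent plane at \<open>x\<close> that are orthonormal for the metric induced by \<open>f\<close> and
  positively oriented with respect to the coordinates of the plane.\<close>

definition oriented_orthonormal_basis ::
  "(real \<times> real \<Rightarrow> complex ^ 2) \<Rightarrow> real \<times> real \<Rightarrow> real \<times> real \<Rightarrow> real \<times> real \<Rightarrow> bool" where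
  "oriented_orthonormal_basis f x e1 e2 \<longleftrightarrow>
     (let D = frechet_derivative f (at x) in
        metric (D e1) (D e1) = 1 \<and> metric (D e2) (D e2) = 1 \<and> metric (D e1) (D e2) = 0) \<and>
     fst e1 * snd e2 - snd e1 * fst e2 > 0"

text \<open>The Lagrangian angle is a class modulo \<open>2 * pi\<close>. As for \<^const>\<open>Arg\<close>, it is given by its
  representative in \<open>{-pi<..pi}\<close>, and equations between angles are to be stated modulo \<open>2 * pi\<close>.
  Independence of the basis is part of what the description requires; if it fails, or if there is
  no oriented orthonormal basis, the value is unspecified.\<close>

definition lagrangian_angle :: "(real \<times> real \<Rightarrow> complex ^ 2) \<Rightarrow> real \<times> real \<Rightarrow> real" where
  "lagrangian_angle f x =
     (THE \<beta>. \<beta> \<in> {-pi<..pi} \<and>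
        (\<forall>e1 e2. oriented_orthonormal_basis f x e1 e2 \<longrightarrow>
           exp (\<i> * complex_of_real \<beta>) =
             dz1_wedge_dz2 (frechet_derivative f (at x) e1) (frechet_derivative f (at x) e2)))"

end

theory Submission
  imports Defs
begin

text \<open>Along a solution the real part of \<open>z\<^sub>1 ^ (p + 1) * z\<^sub>2 ^ (q + 1)\<close> is conserved and nonzero, so the
  components never vanish. Dividing the system by \<open>cnj z\<^sub>j\<close> then shows that \<open>z\<^sub>j'\<close> is a monomial in
  \<open>cnj z\<^sub>1\<close>, \<open>cnj z\<^sub>2\<close>: the components and their conjugates generate an algebra closed under
  differentiation, whence smoothness. The opposite signs in the two systems make the partial
  derivatives of \<open>\<phi>\<close> Hermitian orthogonal, and substituting the monomials into \<open>dz\<^sub>1 \<and> dz\<^sub>2\<close> gives a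
  positive multiple of \<open>cnj (\<phi>\<^sub>1 ^ p * \<phi>\<^sub>2 ^ q)\<close>. On a Lagrangian plane \<open>dz\<^sub>1 \<and> dz\<^sub>2\<close> has modulus 1 on
  orthonormal bases, so only the argument of this number remains.\<close>

subsection \<open>Smoothness from closure under differentiation\<close>

text \<open>On an open set the derivative at a point depends only on values nearby in the set, so
  agreement on \<open>S\<close> passes to every directional derivative, and induction on
  \<open>k\<close> applies.\<close>

lemma Ck_on_cong:
  assumes "open S" "Ck_on k f S" "\<And>x. x \<in> S \<Longrightarrow> f x = g x"
  shows "Ck_on k g S"
  using assms(2,3)
proof (induction k arbitrary: f g)
  case 0
  then show ?case by (simp cong: continuous_on_cong)
next
  case (Suc k)
  have deriv: "(g has_derivative frechet_derivative f (at x)) (at x)" if "x \<in> S" for x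
  proof (rule has_derivative_transform_within_open[OF _ \<open>open S\<close> that])
    show "(f has_derivative frechet_derivative f (at x)) (at x)"
      using Suc.prems(1) that by (simp add: frechet_derivative_works)
  qed (use Suc.prems(2) in auto)
  then have "g differentiable (at x)" if "x \<in> S" for x
    using that by (auto simp: differentiable_def)
  moreover have "Ck_on k (\<lambda>x. frechet_derivative g (at x) v) S" for v
  proof (rule Suc.IH)
    show "Ck_on k (\<lambda>x. frechet_derivative f (at x) v) S"
      using Suc.prems(1) by simp
    show "frechet_derivative f (at x) v = frechet_derivative g (at x) v" if "x \<in> S" for x
      using frechet_derivative_at[OF deriv[OF that]] by simp
  qed
  ultimately show ?case by simp
qed

text \<open>\<open>P\<close> acts as an invariant: its members are differentiable, hence continuous,
  and their directional derivatives stay in \<open>P\<close>. Induction on \<open>k\<close> over all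
  members at once then yields every order without computing a higher derivative.\<close>

lemma smooth_on_coinduct:
  assumes "open S" "f \<in> P"
    and closed: "\<And>g. g \<in> P \<Longrightarrow>
      \<exists>g'. (\<forall>x\<in>S. (g has_derivative g' x) (at x)) \<and> (\<forall>v. (\<lambda>x. g' x v) \<in> P)"
  shows "smooth_on f S"
proof -
  have "\<forall>f\<in>P. Ck_on k f S" for k
  proof (induction k)
    case 0
    show ?case
    proof
      fix f assume "f \<in> P"
      then obtain f' where "\<forall>x\<in>S. (f has_derivative f' x) (at x)"
        using closed by blast
      then show "Ck_on 0 f S"
        by (auto intro!: continuous_at_imp_continuous_on has_derivative_continuous)
    qed
  next
    case (Suc k)
    show ?case
    proof
      fix f assume "f \<in> P"
      then obtain f' where f': "\<forall>x\<in>S. (f has_derivative f' x) (at x)"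
        and P: "\<And>v. (\<lambda>x. f' x v) \<in> P"
        using closed by blast
      have "Ck_on k (\<lambda>x. frechet_derivative f (at x) v) S" for v
      proof (rule Ck_on_cong[OF \<open>open S\<close>])
        show "Ck_on k (\<lambda>x. f' x v) S"
          using Suc P by blast
        show "f' x v = frechet_derivative f (at x) v" if "x \<in> S" for x
          using frechet_derivative_at f' that by metis
      qed
      with f' show "Ck_on (Suc k) f S"
        by (auto simp: differentiable_def)
    qed
  qed
  with \<open>f \<in> P\<close> show ?thesis
    by (simp add: smooth_on_def)
qed

text \<open>Conjugation is not among the operations, so conjugates have to be supplied as
  generators.\<close>

inductive_set generated_algebra :: "('a \<Rightarrow> 'b::real_normed_algebra_1) set \<Rightarrow> ('a \<Rightarrow> 'b) set"
  for B where
  base: "f \<in> B \<Longrightarrow> f \<in> generated_algebra B"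
| const: "(\<lambda>x. c) \<in> generated_algebra B"
| add: "f \<in> generated_algebra B \<Longrightarrow> g \<in> generated_algebra B \<Longrightarrow>
    (\<lambda>x. f x + g x) \<in> generated_algebra B"
| mult: "f \<in> generated_algebra B \<Longrightarrow> g \<in> generated_algebra B \<Longrightarrow>
    (\<lambda>x. f x * g x) \<in> generated_algebra B"

lemma generated_algebra_power:
  "f \<in> generated_algebra B \<Longrightarrow> (\<lambda>x. f x ^ n) \<in> generated_algebra B"
  by (induction n) (auto intro: generated_algebra.intros)

lemma generated_algebra_mono:
  assumes "B \<subseteq> C" "f \<in> generated_algebra B"
  shows "f \<in> generated_algebra C"
  using assms(2,1) by induction (auto intro: generated_algebra.intros)

text \<open>By linearity and the Leibniz rule, closure under differentiation only has to be checked
  on the generators.\<close>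

lemma generated_algebra_derivative:
  assumes "\<And>b. b \<in> B \<Longrightarrow> \<exists>b'. (\<forall>x\<in>S. (b has_derivative b' x) (at x)) \<and>
      (\<forall>v. (\<lambda>x. b' x v) \<in> generated_algebra B)"
    and "f \<in> generated_algebra B"
  shows "\<exists>f'. (\<forall>x\<in>S. (f has_derivative f' x) (at x)) \<and>
      (\<forall>v. (\<lambda>x. f' x v) \<in> generated_algebra B)"
  using assms(2)
proof induction
  case (base f)
  then show ?case by (rule assms(1))
next
  case (const c)
  show ?case
    by (rule exI[of _ "\<lambda>x v. 0"]) (auto intro: generated_algebra.const)
next
  case (add f g)
  then obtain f' g' where
    "\<forall>x\<in>S. (f has_derivative f' x) (at x)" "\<And>v. (\<lambda>x. f' x v) \<in> generated_algebra B"
    "\<forall>x\<in>S. (g has_derivative g' x) (at x)" "\<And>v. (\<lambda>x. g' x v) \<in> generated_algebra B"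
    by auto
  then show ?case
    by (intro exI[of _ "\<lambda>x v. f' x v + g' x v"])
      (auto intro: generated_algebra.intros has_derivative_add)
next
  case (mult f g)
  then obtain f' g' where
    "\<forall>x\<in>S. (f has_derivative f' x) (at x)" "\<And>v. (\<lambda>x. f' x v) \<in> generated_algebra B"
    "\<forall>x\<in>S. (g has_derivative g' x) (at x)" "\<And>v. (\<lambda>x. g' x v) \<in> generated_algebra B"
    by auto
  then show ?case using mult.hyps
    by (intro exI[of _ "\<lambda>x v. f x * g' x v + f' x v * g x"])
      (auto intro!: generated_algebra.add generated_algebra.mult has_derivative_mult)
qed

text \<open>A vector is the sum of its entries embedded by the maps \<open>axis i\<close>, which are
  bounded linear because the entry space is finite-dimensional.\<close>

lemma has_derivative_vec_componentwise:
  fixes f :: "'a::real_normed_vector \<Rightarrow> 'b::euclidean_space ^ 'n"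
  assumes "\<And>i. ((\<lambda>x. f x $ i) has_derivative (\<lambda>v. f' v $ i)) F"
  shows "(f has_derivative f') F"
proof -
  have "(\<lambda>x. \<Sum>i\<in>UNIV. axis i (f x $ i)) = f" "(\<lambda>v. \<Sum>i\<in>UNIV. axis i (f' v $ i)) = f'"
    by (auto simp: vec_eq_iff axis_def if_distrib sum.delta' cong: if_cong)
  moreover have "((\<lambda>x. \<Sum>i\<in>UNIV. axis i (f x $ i)) has_derivative
      (\<lambda>v. \<Sum>i\<in>UNIV. axis i (f' v $ i))) F"
  proof (intro has_derivative_sum bounded_linear.has_derivative[OF _ assms])
    show "bounded_linear (axis i :: 'b \<Rightarrow> 'b ^ 'n)" for i
      by (rule bounded_linearI'[where f = "axis i"])
        (auto simp: vec_eq_iff axis_def)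
  qed
  ultimately show ?thesis by simp
qed

text \<open>The invariant class consists of the vector-valued maps all of whose components lie in
  the algebra.\<close>

lemma smooth_on_generated_algebra:
  fixes f :: "'a::euclidean_space \<Rightarrow> 'b::{real_normed_algebra_1, euclidean_space} ^ 'n"
  assumes "open S"
    and B: "\<And>b. b \<in> B \<Longrightarrow> \<exists>b'. (\<forall>x\<in>S. (b has_derivative b' x) (at x)) \<and>
      (\<forall>v. (\<lambda>x. b' x v) \<in> generated_algebra B)"
    and f: "\<And>i. (\<lambda>x. f x $ i) \<in> generated_algebra B"
  shows "smooth_on f S"
proof (rule smooth_on_coinduct[OF \<open>open S\<close>])
  show "f \<in> {f. \<forall>i. (\<lambda>x. f x $ i) \<in> generated_algebra B}"
    using f by simp
next
  fix g :: "'a \<Rightarrow> 'b ^ 'n"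
  assume "g \<in> {f. \<forall>i. (\<lambda>x. f x $ i) \<in> generated_algebra B}"
  then have "\<forall>i. \<exists>h. (\<forall>x\<in>S. ((\<lambda>x. g x $ i) has_derivative h x) (at x)) \<and>
      (\<forall>v. (\<lambda>x. h x v) \<in> generated_algebra B)"
    by (auto intro: generated_algebra_derivative[OF B])
  then obtain h where h: "\<And>i x. x \<in> S \<Longrightarrow> ((\<lambda>x. g x $ i) has_derivative h i x) (at x)"
    "\<And>i v. (\<lambda>x. h i x v) \<in> generated_algebra B"
    by metis
  show "\<exists>g'. (\<forall>x\<in>S. (g has_derivative g' x) (at x)) \<and>
      (\<forall>v. (\<lambda>x. g' x v) \<in> {f. \<forall>i. (\<lambda>x. f x $ i) \<in> generated_algebra B})"
    by (rule exI[of _ "\<lambda>x v. \<chi> i. h i x v"])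
      (auto intro!: has_derivative_vec_componentwise simp: h)
qed

subsection \<open>Solutions of the monomial system\<close>

text \<open>Both systems of the theorem are instances: \<open>c\<close> takes the values 1, 1 for
  the first and 1, -1 for the second. The condition \<open>initial\<close> is what the conservation
  law needs of the starting point.\<close>

locale monomial_system =
  fixes p q :: nat and c :: "2 \<Rightarrow> real" and I :: "real set" and \<zeta> \<zeta>' :: "real \<Rightarrow> complex ^ 2"
  assumes open_I: "open I" and interval_I: "is_interval I" and zero_in_I: "0 \<in> I"
    and deriv: "t \<in> I \<Longrightarrow> (\<zeta> has_vector_derivative \<zeta>' t) (at t)"
    and ode: "t \<in> I \<Longrightarrow> \<zeta>' t $ j * cnj (\<zeta> t $ j) =
      \<i> * of_real (c j) * (cnj (\<zeta> t $ 1) ^ (p + 1) * cnj (\<zeta> t $ 2) ^ (q + 1))"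
    and initial: "Re (\<zeta> 0 $ 1 ^ (p + 1) * \<zeta> 0 $ 2 ^ (q + 1)) \<noteq> 0"
begin

lemma component_deriv:
  assumes "t \<in> I"
  shows "((\<lambda>t. \<zeta> t $ j) has_vector_derivative \<zeta>' t $ j) (at t)"
  by (rule bounded_linear.has_vector_derivative[OF bounded_linear_vec_nth deriv[OF assms]])

lemma derivative_eq:
  assumes "t \<in> I" "\<zeta> t $ 1 \<noteq> 0" "\<zeta> t $ 2 \<noteq> 0"
  shows "\<zeta>' t $ 1 = \<i> * of_real (c 1) * (cnj (\<zeta> t $ 1) ^ p * cnj (\<zeta> t $ 2) ^ (q + 1))"
    and "\<zeta>' t $ 2 = \<i> * of_real (c 2) * (cnj (\<zeta> t $ 1) ^ (p + 1) * cnj (\<zeta> t $ 2) ^ q)"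
  using ode[OF assms(1), of 1] ode[OF assms(1), of 2] assms(2,3) by simp_all

definition invariant :: "real \<Rightarrow> real" where
  "invariant t = Re (\<zeta> t $ 1 ^ (p + 1) * \<zeta> t $ 2 ^ (q + 1))"

text \<open>Inserting the monomials for the derivatives pairs every power with its conjugate. As
  \<open>c\<close> is real, the product whose real part is taken has derivative \<i> times a real
  combination of squared moduli.\<close>

lemma invariant_deriv:
  assumes "t \<in> I" "\<zeta> t $ 1 \<noteq> 0" "\<zeta> t $ 2 \<noteq> 0"
  shows "(invariant has_derivative (\<lambda>h. 0)) (at t)"
proof -
  let ?z = "\<zeta> t $ 1" and ?w = "\<zeta> t $ 2"
  let ?d = "?z ^ (p + 1) * (of_nat (q + 1) * \<zeta>' t $ 2 * ?w ^ q) +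
    of_nat (p + 1) * \<zeta>' t $ 1 * ?z ^ p * ?w ^ (q + 1)"
  have power: "((\<lambda>t. \<zeta> t $ j ^ n) has_derivative
      (\<lambda>h. of_nat n * (h *\<^sub>R \<zeta>' t $ j) * \<zeta> t $ j ^ (n - 1))) (at t)" for j n
    using component_deriv[OF assms(1), of j] unfolding has_vector_derivative_def
    by (rule has_derivative_power)
  have "((\<lambda>t. \<zeta> t $ 1 ^ (p + 1) * \<zeta> t $ 2 ^ (q + 1)) has_derivative (\<lambda>h. h *\<^sub>R ?d)) (at t)"
    using has_derivative_mult[OF power[of 1 "p + 1"] power[of 2 "q + 1"]]
    by (simp add: algebra_simps)
  then have "(invariant has_derivative (\<lambda>h. Re (h *\<^sub>R ?d))) (at t)"
    unfolding invariant_def[abs_def] by (rule has_derivative_Re)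
  moreover have "?d = \<i> * of_real (real (q + 1) * c 2 * (cmod (?z ^ (p + 1) * ?w ^ q))\<^sup>2 +
      real (p + 1) * c 1 * (cmod (?z ^ p * ?w ^ (q + 1)))\<^sup>2)"
    unfolding of_real_add of_real_mult complex_norm_square derivative_eq[OF assms] of_real_of_nat_eq
    by (simp add: algebra_simps)
  then have "Re (h *\<^sub>R ?d) = 0" for h
    by simp
  ultimately show ?thesis by (simp only:)
qed

text \<open>The invariant is locally constant only away from the zeros of the components, so its
  constancy and the absence of zeros have to be propagated together.\<close>

lemma nonzero:
  assumes "t \<in> I"
  shows "\<zeta> t $ j \<noteq> 0"
proof -
  define E where "E = {t \<in> I. invariant t = invariant 0}"
  \<comment> \<open>The exponents \<open>p + 1\<close> and \<open>q + 1\<close> are positive, so a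
    zero of either component would make the invariant vanish, contrary to
    \<open>initial\<close>.\<close>
  have nz: "\<zeta> t $ 1 \<noteq> 0 \<and> \<zeta> t $ 2 \<noteq> 0" if "t \<in> E" for t
    using that initial unfolding E_def invariant_def by auto
  have cont_\<zeta>: "continuous_on I \<zeta>"
    using deriv has_vector_derivative_continuous
    by (blast intro: continuous_at_imp_continuous_on)
  then have "continuous_on I invariant"
    unfolding invariant_def[abs_def] by (intro continuous_intros) auto
  then have "closedin (top_of_set I) E"
    unfolding E_def by (rule continuous_closedin_preimage_constant)
  moreover have "open E"
  proof (rule openI)
    fix t assume t: "t \<in> E"
    \<comment> \<open>On a ball inside \<open>U\<close> neither component vanishes, so the invariant
      has zero derivative there and keeps its value at the centre.\<close>
    define U where "U = I \<inter> (\<lambda>t. \<zeta> t $ 1 * \<zeta> t $ 2) -` (- {0})"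
    have "continuous_on I (\<lambda>t. \<zeta> t $ 1 * \<zeta> t $ 2)"
      using cont_\<zeta> by (intro continuous_intros)
    then have "open U"
      unfolding U_def using open_I by (rule continuous_open_preimage) auto
    moreover have "t \<in> U"
      using t nz by (auto simp: U_def E_def)
    ultimately obtain e where e: "e > 0" "ball t e \<subseteq> U"
      using openE by blast
    have "(invariant has_derivative (\<lambda>h. 0)) (at u within ball t e)" if "u \<in> ball t e" for u
    proof -
      have "u \<in> U" using that e(2) by (rule subsetD[rotated])
      then have "u \<in> I" "\<zeta> u $ 1 \<noteq> 0" "\<zeta> u $ 2 \<noteq> 0"
        by (simp_all add: U_def)
      then show ?thesis
        by (rule has_derivative_at_withinI[OF invariant_deriv])
    qed
    from has_derivative_zero_constant[OF convex_ball this]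
    obtain k where k: "\<And>u. u \<in> ball t e \<Longrightarrow> invariant u = k"
      by auto
    have "invariant t = invariant 0"
      using t by (simp add: E_def)
    with k[of t] e(1) have "k = invariant 0"
      by simp
    moreover have "ball t e \<subseteq> I"
      using e(2) by (auto simp: U_def)
    ultimately have "ball t e \<subseteq> E"
      using k by (auto simp: E_def)
    with e show "\<exists>e>0. ball t e \<subseteq> E" by blast
  qed
  then have "openin (top_of_set I) E"
    by (rule open_subset[rotated]) (auto simp: E_def)
  moreover have "0 \<in> E"
    using zero_in_I by (simp add: E_def)
  moreover have "connected I"
    using interval_I by (simp add: is_interval_connected)
  ultimately have "E = I"
    unfolding connected_clopen by blast
  with assms have "t \<in> E" by simp
  with nz show ?thesis
    using exhaust_2[of j] by auto
qed

text \<open>The pullback along \<pi>, later \<open>fst\<close> or \<open>snd\<close>, turns the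
  coordinates of both solutions into functions on the same plane.\<close>

definition coordinates :: "('a \<Rightarrow> real) \<Rightarrow> ('a \<Rightarrow> complex) set" where
  "coordinates \<pi> = (\<Union>j. {\<lambda>x. \<zeta> (\<pi> x) $ j, \<lambda>x. cnj (\<zeta> (\<pi> x) $ j)})"

text \<open>The derivative of a component is a monomial in the conjugates, and that of a conjugate
  is a monomial in the components, up to constants.\<close>

lemma coordinates_derivative:
  fixes \<pi> :: "'a::real_normed_vector \<Rightarrow> real"
  assumes \<pi>: "bounded_linear \<pi>" "\<pi> ` S \<subseteq> I" and b: "b \<in> coordinates \<pi>"
  shows "\<exists>b'. (\<forall>x\<in>S. (b has_derivative b' x) (at x)) \<and>
    (\<forall>v. (\<lambda>x. b' x v) \<in> generated_algebra (coordinates \<pi>))"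
proof -
  let ?A = "generated_algebra (coordinates \<pi>)"
  \<comment> \<open>Membership in the algebra concerns functions on the whole type, whereas \<zeta>'
    is controlled on \<open>I\<close> only. The globally defined monomial \<open>d\<close> therefore
    replaces \<zeta>'.\<close>
  define m where "m j x = (if j = 1
      then \<zeta> (\<pi> x) $ 1 ^ p * \<zeta> (\<pi> x) $ 2 ^ (q + 1)
      else \<zeta> (\<pi> x) $ 1 ^ (p + 1) * \<zeta> (\<pi> x) $ 2 ^ q)" for j :: 2 and x
  define d where "d j x = \<i> * of_real (c j) * cnj (m j x)" for j x
  have comp: "(\<lambda>x. \<zeta> (\<pi> x) $ j) \<in> ?A" "(\<lambda>x. cnj (\<zeta> (\<pi> x) $ j)) \<in> ?A" for j
    by (rule generated_algebra.base; auto simp: coordinates_def)+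
  have m: "(\<lambda>x. m j x) \<in> ?A" for j
    unfolding m_def by (cases "j = 1"; simp only: simp_thms if_True if_False;
        intro generated_algebra.mult generated_algebra_power comp)
  have cnj_m: "(\<lambda>x. cnj (m j x)) \<in> ?A" for j
    unfolding m_def by (cases "j = 1"; simp only: simp_thms if_True if_False complex_cnj_mult complex_cnj_power;
        intro generated_algebra.mult generated_algebra_power comp)
  have d: "(\<lambda>x. d j x) \<in> ?A" for j
    unfolding d_def by (intro generated_algebra.mult generated_algebra.const cnj_m)
  have cnj_d: "(\<lambda>x. cnj (d j x)) \<in> ?A" for j
    unfolding d_def complex_cnj_mult complex_cnj_cnj
    by (intro generated_algebra.mult generated_algebra.const m)
  have deriv_d: "((\<lambda>x. \<zeta> (\<pi> x) $ j) has_derivative (\<lambda>v. of_real (\<pi> v) * d j x)) (at x)"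
    if "x \<in> S" for j x
  proof -
    have "\<pi> x \<in> I" using that \<pi> by auto
    then have "((\<lambda>t. \<zeta> t $ j) has_derivative (\<lambda>h. h *\<^sub>R d j x)) (at (\<pi> x))"
      using component_deriv[of "\<pi> x" j] derivative_eq[of "\<pi> x"] nonzero[of "\<pi> x"] exhaust_2[of j]
      by (auto simp: d_def m_def has_vector_derivative_def)
    from has_derivative_compose[OF bounded_linear_imp_has_derivative[OF \<pi>(1)] this]
    show ?thesis by (simp add: scaleR_conv_of_real)
  qed
  from b obtain j where "b = (\<lambda>x. \<zeta> (\<pi> x) $ j) \<or> b = (\<lambda>x. cnj (\<zeta> (\<pi> x) $ j))"
    by (auto simp: coordinates_def)
  then show ?thesis
  proof
    assume "b = (\<lambda>x. \<zeta> (\<pi> x) $ j)"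
    then show ?thesis
      by (intro exI[of _ "\<lambda>x v. of_real (\<pi> v) * d j x"])
        (auto intro: deriv_d generated_algebra.intros d)
  next
    assume "b = (\<lambda>x. cnj (\<zeta> (\<pi> x) $ j))"
    moreover have "((\<lambda>x. cnj (\<zeta> (\<pi> x) $ j)) has_derivative
        (\<lambda>v. of_real (\<pi> v) * cnj (d j x))) (at x)" if "x \<in> S" for x
      using has_derivative_cnj[OF deriv_d[OF that, of j]] by simp
    ultimately show ?thesis
      by (intro exI[of _ "\<lambda>x v. of_real (\<pi> v) * cnj (d j x)"])
        (auto intro: generated_algebra.intros cnj_d)
  qed
qed

end

subsection \<open>Hermitian-orthogonal frames\<close>

lemma herm_2: "herm u v = u $ 1 * cnj (v $ 1) + u $ 2 * cnj (v $ 2)"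
  by (simp add: herm_def sum_2)

lemma herm_cnj: "cnj (herm u v) = herm v u"
  by (simp add: herm_2 mult.commute)

lemma herm_self: "herm u u = of_real (metric u u)"
  by (simp add: complex_eq_iff herm_2 metric_def)

lemma metric_self_pos: "u \<noteq> 0 \<Longrightarrow> metric u u > 0"
proof -
  assume "u \<noteq> 0"
  then have "u $ 1 \<noteq> 0 \<or> u $ 2 \<noteq> 0"
    by (auto simp: vec_eq_iff forall_2)
  then have "(cmod (u $ 1))\<^sup>2 + (cmod (u $ 2))\<^sup>2 > 0"
    by (auto intro: add_pos_nonneg add_nonneg_pos)
  then show ?thesis
    unfolding cmod_power2 by (simp add: metric_def herm_2 power2_eq_square)
qed

text \<open>Hermitian orthogonality kills the mixed terms completely, so real combinations of
  \<open>X\<close> and \<open>Y\<close> have real Hermitian products: their real span is a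
  Lagrangian plane when \<open>X\<close> and \<open>Y\<close> are nonzero.\<close>

lemma herm_frame:
  assumes "herm X Y = 0"
  shows "herm (a *\<^sub>R X + b *\<^sub>R Y) (c *\<^sub>R X + d *\<^sub>R Y) =
    of_real (a * c * metric X X + b * d * metric Y Y)"
proof -
  have "herm Y X = 0"
    using assms herm_cnj[of X Y] by simp
  have "herm (a *\<^sub>R X + b *\<^sub>R Y) (c *\<^sub>R X + d *\<^sub>R Y) =
      of_real (a * c) * herm X X + of_real (a * d) * herm X Y +
      of_real (b * c) * herm Y X + of_real (b * d) * herm Y Y"
    by (simp add: herm_2 scaleR_conv_of_real[where 'a = complex] algebra_simps)
  with assms \<open>herm Y X = 0\<close> show ?thesis
    by (simp add: herm_self)
qed

lemma dz1_wedge_dz2_frame: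
  "dz1_wedge_dz2 (a *\<^sub>R X + b *\<^sub>R Y) (c *\<^sub>R X + d *\<^sub>R Y) =
    of_real (a * d - b * c) * dz1_wedge_dz2 X Y"
  by (simp add: dz1_wedge_dz2_def scaleR_conv_of_real[where 'a = complex] algebra_simps)

text \<open>Lagrange's identity: the squared modulus of the determinant is the Gram determinant of
  the Hermitian product.\<close>

lemma norm_dz1_wedge_dz2:
  "(cmod (dz1_wedge_dz2 u v))\<^sup>2 = metric u u * metric v v - (cmod (herm u v))\<^sup>2"
proof -
  have "complex_of_real ((cmod (dz1_wedge_dz2 u v))\<^sup>2) =
      of_real (metric u u * metric v v - (cmod (herm u v))\<^sup>2)"
    unfolding of_real_diff of_real_mult complex_norm_square herm_self[symmetric]
    by (simp add: herm_2 dz1_wedge_dz2_def algebra_simps)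
  then show ?thesis
    by (simp only: of_real_eq_iff)
qed

text \<open>By Pythagoras the squared length of the image of a difference is a positive definite
  form in its coordinates.\<close>

lemma inj_frame:
  assumes "herm X Y = 0" "X \<noteq> 0" "Y \<noteq> 0"
  shows "inj (\<lambda>v. fst v *\<^sub>R X + snd v *\<^sub>R Y)" (is "inj ?D")
proof (rule injI)
  fix u v assume "?D u = ?D v"
  then have 0: "(fst u - fst v) *\<^sub>R X + (snd u - snd v) *\<^sub>R Y = 0"
    by (simp add: algebra_simps)
  have "(fst u - fst v)\<^sup>2 * metric X X + (snd u - snd v)\<^sup>2 * metric Y Y = 0"
    using herm_frame[OF assms(1), of "fst u - fst v" "snd u - snd v" "fst u - fst v" "snd u - snd v"]
    unfolding 0 by (simp add: herm_2 power2_eq_square del: of_real_add of_real_mult)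
  moreover have "metric X X > 0" "metric Y Y > 0"
    using assms metric_self_pos by auto
  ultimately have "(fst u - fst v)\<^sup>2 = 0" "(snd u - snd v)\<^sup>2 = 0"
    by (auto simp: add_nonneg_eq_0_iff)
  then show "u = v"
    by (simp add: prod_eq_iff)
qed

text \<open>Passing from \<open>X\<close>, \<open>Y\<close> to an oriented orthonormal basis
  multiplies the determinant by a positive real, which leaves its argument \<theta> unchanged, and
  normalises its modulus to 1.\<close>

lemma lagrangian_angle_frame:
  assumes D: "frechet_derivative f (at x) = (\<lambda>v. fst v *\<^sub>R X + snd v *\<^sub>R Y)"
    and XY: "herm X Y = 0" "X \<noteq> 0" "Y \<noteq> 0"
    and dz: "dz1_wedge_dz2 X Y = of_real r * cis \<theta>" "r > 0"
  shows "[lagrangian_angle f x = \<theta>] (rmod 2 * pi)"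
proof -
  have basis: "dz1_wedge_dz2 (frechet_derivative f (at x) e1) (frechet_derivative f (at x) e2) = cis \<theta>"
    if "oriented_orthonormal_basis f x e1 e2" for e1 e2
  proof -
    let ?u = "frechet_derivative f (at x) e1" and ?v = "frechet_derivative f (at x) e2"
    let ?\<delta> = "fst e1 * snd e2 - snd e1 * fst e2"
    have orth: "metric ?u ?u = 1" "metric ?v ?v = 1" "metric ?u ?v = 0" "?\<delta> > 0"
      using that by (auto simp: oriented_orthonormal_basis_def Let_def)
    \<comment> \<open>Metric orthogonality gives only a vanishing real part; the imaginary part
      vanishes because the plane is Lagrangian.\<close>
    have "herm ?u ?v = 0"
      using orth(3) herm_frame[OF XY(1), of "fst e1" "snd e1" "fst e2" "snd e2"]
      unfolding D metric_def by simp
    then have "(cmod (dz1_wedge_dz2 ?u ?v))\<^sup>2 = 1"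
      by (simp add: norm_dz1_wedge_dz2 orth)
    then have "cmod (dz1_wedge_dz2 ?u ?v) = 1"
      using norm_ge_zero power2_eq_1_iff by (metis abs_norm_cancel abs_square_eq_1)
    moreover have wedge: "dz1_wedge_dz2 ?u ?v = of_real (?\<delta> * r) * cis \<theta>"
      unfolding D dz1_wedge_dz2_frame dz by simp
    moreover have "cmod (of_real (?\<delta> * r) * cis \<theta>) = ?\<delta> * r"
      unfolding norm_mult norm_of_real norm_cis using orth(4) dz(2) by simp
    ultimately have "?\<delta> * r = 1"
      by simp
    with wedge show ?thesis
      by (metis mult_1 of_real_1)
  qed
  \<comment> \<open>Without such a basis the condition defining the angle would be vacuous and
    \<open>THE\<close> unspecified. As \<open>X\<close> and \<open>Y\<close> are orthogonal,
    rescaling each of them suffices.\<close>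
  obtain e1 e2 where e: "oriented_orthonormal_basis f x e1 e2"
  proof
    let ?a = "1 / sqrt (metric X X)" and ?b = "1 / sqrt (metric Y Y)"
    have pos: "metric X X > 0" "metric Y Y > 0"
      using XY metric_self_pos by auto
    show "oriented_orthonormal_basis f x (?a, 0) (0, ?b)"
      using pos herm_frame[OF XY(1), of ?a 0 ?a 0] herm_frame[OF XY(1), of 0 ?b 0 ?b]
        herm_frame[OF XY(1), of ?a 0 0 ?b]
      unfolding oriented_orthonormal_basis_def D Let_def
      by (simp add: metric_def)
  qed
  let ?P = "\<lambda>\<beta>. \<beta> \<in> {-pi<..pi} \<and> (\<forall>e1 e2. oriented_orthonormal_basis f x e1 e2 \<longrightarrow>
      exp (\<i> * complex_of_real \<beta>) =
        dz1_wedge_dz2 (frechet_derivative f (at x) e1) (frechet_derivative f (at x) e2))"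
  have P_iff: "?P \<beta> \<longleftrightarrow> \<beta> \<in> {-pi<..pi} \<and> cis \<beta> = cis \<theta>" for \<beta>
    unfolding cis_conv_exp[symmetric] using e basis by metis
  \<comment> \<open>The principal argument is the unique representative of \<theta> in the half-open
    interval, so the description is proper.\<close>
  have "?P (Arg (cis \<theta>))"
    unfolding P_iff using Arg_bounded[of "cis \<theta>"] cis_Arg[of "cis \<theta>"] by (auto simp: sgn_eq)
  moreover have "\<beta> = Arg (cis \<theta>)" if "?P \<beta>" for \<beta>
    using that unfolding P_iff by (metis Arg_cis greaterThanAtMost_iff)
  ultimately have "?P (lagrangian_angle f x)"
    unfolding lagrangian_angle_def by (rule theI[where P = ?P])
  then show ?thesis
    unfolding P_iff cis_eq_iff by simp
qed

section \<open>The product of the two solutions and its Lagrangian angle\<close>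

theorem corollary1:
  fixes p q :: nat
    and a1 a2 b1 b2 :: real
    and I J :: "real set"
    and \<alpha> \<alpha>' \<gamma> \<gamma>' :: "real \<Rightarrow> complex ^ 2"
    and \<phi> :: "real \<times> real \<Rightarrow> complex ^ 2"
  assumes "a1 > 0" "a2 > 0" "b1 > 0" "b2 > 0"
    and "open I" "is_interval I" "0 \<in> I"
    and "open J" "is_interval J" "0 \<in> J"
    and "\<And>t. t \<in> I \<Longrightarrow> (\<alpha> has_vector_derivative \<alpha>' t) (at t)"
    and "\<And>t. t \<in> I \<Longrightarrow>
           \<alpha>' t $ 1 * cnj (\<alpha> t $ 1) = \<i> * cnj (\<alpha> t $ 1) ^ (p + 1) * cnj (\<alpha> t $ 2) ^ (q + 1)"
    and "\<And>t. t \<in> I \<Longrightarrow>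
           \<alpha>' t $ 2 * cnj (\<alpha> t $ 2) = \<i> * cnj (\<alpha> t $ 1) ^ (p + 1) * cnj (\<alpha> t $ 2) ^ (q + 1)"
    and "\<alpha> 0 $ 1 = complex_of_real a1" "\<alpha> 0 $ 2 = complex_of_real a2"
    and "\<And>s. s \<in> J \<Longrightarrow> (\<gamma> has_vector_derivative \<gamma>' s) (at s)"
    and "\<And>s. s \<in> J \<Longrightarrow>
           \<gamma>' s $ 1 * cnj (\<gamma> s $ 1) = \<i> * cnj (\<gamma> s $ 1) ^ (p + 1) * cnj (\<gamma> s $ 2) ^ (q + 1)"
    and "\<And>s. s \<in> J \<Longrightarrow>
           \<gamma>' s $ 2 * cnj (\<gamma> s $ 2) = - \<i> * cnj (\<gamma> s $ 1) ^ (p + 1) * cnj (\<gamma> s $ 2) ^ (q + 1)"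
    and "\<gamma> 0 $ 1 = complex_of_real b1" "\<gamma> 0 $ 2 = complex_of_real b2"
    and "\<phi> = (\<lambda>(t, s). \<chi> j. \<alpha> t $ j * \<gamma> s $ j)"
  shows "lagrangian_immersion_on \<phi> (I \<times> J) \<and>
    (\<forall>x \<in> I \<times> J.
       \<phi> x $ 1 \<noteq> 0 \<and> \<phi> x $ 2 \<noteq> 0 \<and>
       [lagrangian_angle \<phi> x + real p * Arg (\<phi> x $ 1) + real q * Arg (\<phi> x $ 2) = 0] (rmod 2 * pi))"
proof -
  interpret \<alpha>: monomial_system p q "\<lambda>_. 1" I \<alpha> \<alpha>'
  proof
    show "\<alpha>' t $ j * cnj (\<alpha> t $ j) = \<i> * of_real 1 *
        (cnj (\<alpha> t $ 1) ^ (p + 1) * cnj (\<alpha> t $ 2) ^ (q + 1))" if "t \<in> I" for t j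
      using assms(12,13)[OF that] exhaust_2[of j] by (auto simp: mult.assoc)
    show "Re (\<alpha> 0 $ 1 ^ (p + 1) * \<alpha> 0 $ 2 ^ (q + 1)) \<noteq> 0"
      using assms by (simp flip: of_real_power of_real_mult)
  qed (use assms in auto)
  interpret \<gamma>: monomial_system p q "\<lambda>j. if j = 1 then 1 else - 1" J \<gamma> \<gamma>'
  proof
    show "\<gamma>' s $ j * cnj (\<gamma> s $ j) = \<i> * of_real (if j = 1 then 1 else - 1) *
        (cnj (\<gamma> s $ 1) ^ (p + 1) * cnj (\<gamma> s $ 2) ^ (q + 1))" if "s \<in> J" for s j
      using assms(17,18)[OF that] exhaust_2[of j] by (auto simp: mult.assoc)
    show "Re (\<gamma> 0 $ 1 ^ (p + 1) * \<gamma> 0 $ 2 ^ (q + 1)) \<noteq> 0"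
      using assms by (simp flip: of_real_power of_real_mult)
  qed (use assms in auto)
  \<comment> \<open>Joint generators on the plane: each component of \<phi> is a product of two of
    them.\<close>
  let ?B = "\<alpha>.coordinates fst \<union> \<gamma>.coordinates (snd :: real \<times> real \<Rightarrow> real)"
  have \<phi>: "\<phi> x $ j = \<alpha> (fst x) $ j * \<gamma> (snd x) $ j" for x j
    by (simp add: assms(21) case_prod_unfold)

  have smooth: "smooth_on \<phi> (I \<times> J)"
  proof (rule smooth_on_generated_algebra)
    show "open (I \<times> J)"
      using \<alpha>.open_I \<gamma>.open_I by (rule open_Times)
    show "(\<lambda>x. \<phi> x $ j) \<in> generated_algebra ?B" for j
      unfolding \<phi>
      by (intro generated_algebra.mult generated_algebra.base)
        (auto simp: \<alpha>.coordinates_def \<gamma>.coordinates_def)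
    fix b assume "b \<in> ?B"
    then consider "b \<in> \<alpha>.coordinates fst" | "b \<in> \<gamma>.coordinates snd" by blast
    then show "\<exists>b'. (\<forall>x\<in>I \<times> J. (b has_derivative b' x) (at x)) \<and>
        (\<forall>v. (\<lambda>x. b' x v) \<in> generated_algebra ?B)"
    proof cases
      case 1
      have "fst ` (I \<times> J) \<subseteq> I" by auto
      from \<alpha>.coordinates_derivative[OF bounded_linear_fst this 1] show ?thesis
        using generated_algebra_mono[OF Un_upper1] by blast
    next
      case 2
      have "snd ` (I \<times> J) \<subseteq> J" by auto
      from \<gamma>.coordinates_derivative[OF bounded_linear_snd this 2] show ?thesis
        using generated_algebra_mono[OF Un_upper2] by blast
    qed
  qed

  \<comment> \<open>\<open>X\<close> and \<open>Y\<close> are the partial derivatives of \<phi> in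
    \<open>t\<close> and \<open>s\<close>; on the domain they form the orthogonal frame.\<close>
  define X where "X x = (\<chi> j. \<alpha>' (fst x) $ j * \<gamma> (snd x) $ j)" for x
  define Y where "Y x = (\<chi> j. \<alpha> (fst x) $ j * \<gamma>' (snd x) $ j)" for x
  have D: "frechet_derivative \<phi> (at x) = (\<lambda>v. fst v *\<^sub>R X x + snd v *\<^sub>R Y x)"
    and orth: "herm (X x) (Y x) = 0" and nz: "X x \<noteq> 0" "Y x \<noteq> 0" "\<phi> x $ j \<noteq> 0"
    and angle: "[lagrangian_angle \<phi> x =
      - (real p * Arg (\<phi> x $ 1) + real q * Arg (\<phi> x $ 2))] (rmod 2 * pi)"
    if x_in: "x \<in> I \<times> J" for x j
  proof -
    obtain t s where x: "x = (t, s)" and ts: "t \<in> I" "s \<in> J"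
      using x_in by auto
    let ?z1 = "\<alpha> t $ 1" and ?z2 = "\<alpha> t $ 2" and ?w1 = "\<gamma> s $ 1" and ?w2 = "\<gamma> s $ 2"
    note nonzero = \<alpha>.nonzero[OF ts(1)] \<gamma>.nonzero[OF ts(2)]
    note d\<alpha> = \<alpha>.derivative_eq[OF ts(1) nonzero(1,1)]
    note d\<gamma> = \<gamma>.derivative_eq[OF ts(2) nonzero(2,2)]
    show nz\<phi>: "\<phi> x $ j \<noteq> 0" for j
      using nonzero by (simp add: \<phi> x)
    have "(\<phi> has_derivative (\<lambda>v. fst v *\<^sub>R X x + snd v *\<^sub>R Y x)) (at x)"
    proof (rule has_derivative_vec_componentwise)
      fix j
      have "((\<lambda>t. \<alpha> t $ j) has_derivative (\<lambda>h. h *\<^sub>R \<alpha>' t $ j)) (at (fst x))"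
        using \<alpha>.component_deriv[OF ts(1)] by (simp add: x has_vector_derivative_def)
      note d1 = has_derivative_compose[OF bounded_linear_imp_has_derivative[OF bounded_linear_fst] this]
      have "((\<lambda>s. \<gamma> s $ j) has_derivative (\<lambda>h. h *\<^sub>R \<gamma>' s $ j)) (at (snd x))"
        using \<gamma>.component_deriv[OF ts(2)] by (simp add: x has_vector_derivative_def)
      note d2 = has_derivative_compose[OF bounded_linear_imp_has_derivative[OF bounded_linear_snd] this]
      show "((\<lambda>x. \<phi> x $ j) has_derivative (\<lambda>v. (fst v *\<^sub>R X x + snd v *\<^sub>R Y x) $ j)) (at x)"
        unfolding \<phi> using has_derivative_mult[OF d1 d2]
        by (simp add: X_def Y_def x add.commute)
    qed
    then show D: "frechet_derivative \<phi> (at x) = (\<lambda>v. fst v *\<^sub>R X x + snd v *\<^sub>R Y x)"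
      by (rule frechet_derivative_at[symmetric])
    show orth: "herm (X x) (Y x) = 0"
    proof -
      \<comment> \<open>Regrouped this way, every factor is a left-hand side of one of the systems.
        The two summands then differ only in the sign carried by the second equation for \<gamma>,
        and they cancel.\<close>
      have "herm (X x) (Y x) =
          (\<alpha>' t $ 1 * cnj ?z1) * cnj (\<gamma>' s $ 1 * cnj ?w1) +
          (\<alpha>' t $ 2 * cnj ?z2) * cnj (\<gamma>' s $ 2 * cnj ?w2)"
        by (simp add: herm_2 X_def Y_def x algebra_simps)
      then show ?thesis
        unfolding \<alpha>.ode[OF ts(1)] \<gamma>.ode[OF ts(2)] by simp
    qed
    have "X x $ 1 \<noteq> 0" "Y x $ 1 \<noteq> 0"
      using nonzero by (simp_all add: X_def Y_def x d\<alpha> d\<gamma>)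
    then show nzXY: "X x \<noteq> 0" "Y x \<noteq> 0"
      by auto
    show "[lagrangian_angle \<phi> x =
      - (real p * Arg (\<phi> x $ 1) + real q * Arg (\<phi> x $ 2))] (rmod 2 * pi)"
    proof (rule lagrangian_angle_frame[OF D orth nzXY])
      \<comment> \<open>The opposite sign in the second equation for \<gamma> makes both terms of
        the determinant add up. Extracting the conjugate of
        \<open>\<phi> x $ 1 ^ p * \<phi> x $ 2 ^ q\<close> leaves one squared modulus from
        each.\<close>
      define \<rho> where "\<rho> = (cmod (?w1 * ?z2))\<^sup>2 + (cmod (?z1 * ?w2))\<^sup>2"
      let ?\<theta> = "real p * Arg (\<phi> x $ 1) + real q * Arg (\<phi> x $ 2)"
      have "\<phi> x $ 1 ^ p * \<phi> x $ 2 ^ q =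
          (of_real (cmod (\<phi> x $ 1)) * cis (Arg (\<phi> x $ 1))) ^ p *
          (of_real (cmod (\<phi> x $ 2)) * cis (Arg (\<phi> x $ 2))) ^ q"
        using rcis_cmod_Arg by (simp add: rcis_def)
      also have "\<dots> = of_real (cmod (\<phi> x $ 1) ^ p * cmod (\<phi> x $ 2) ^ q) * cis ?\<theta>"
        unfolding power_mult_distrib Complex.DeMoivre of_real_mult of_real_power cis_mult[symmetric]
        by (simp only: mult_ac)
      \<comment> \<open>Conjugation reverses the angle, hence the minus sign in the congruence for
        the Lagrangian angle.\<close>
      finally have polar: "cnj (\<phi> x $ 1 ^ p * \<phi> x $ 2 ^ q) =
          of_real (cmod (\<phi> x $ 1) ^ p * cmod (\<phi> x $ 2) ^ q) * cis (- ?\<theta>)"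
        by (simp add: cis_cnj)
      have "dz1_wedge_dz2 (X x) (Y x) = of_real \<rho> * cnj (\<phi> x $ 1 ^ p * \<phi> x $ 2 ^ q)"
        unfolding \<rho>_def of_real_add complex_norm_square
        by (simp add: dz1_wedge_dz2_def X_def Y_def x d\<alpha> d\<gamma> \<phi> power_mult_distrib algebra_simps)
      then show "dz1_wedge_dz2 (X x) (Y x) =
          of_real (\<rho> * (cmod (\<phi> x $ 1) ^ p * cmod (\<phi> x $ 2) ^ q)) * cis (- ?\<theta>)"
        unfolding polar by simp
      show "\<rho> * (cmod (\<phi> x $ 1) ^ p * cmod (\<phi> x $ 2) ^ q) > 0"
        using nonzero nz\<phi> unfolding \<rho>_def
        by (intro mult_pos_pos add_pos_pos) auto
    qed
  qed

  have "kaehler_form (frechet_derivative \<phi> (at x) u) (frechet_derivative \<phi> (at x) v) = 0"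
    if "x \<in> I \<times> J" for x u v
    unfolding D[OF that] kaehler_form_def herm_frame[OF orth[OF that]] by simp
  moreover have "inj (frechet_derivative \<phi> (at x))" if "x \<in> I \<times> J" for x
    unfolding D[OF that] using orth nz that by (intro inj_frame)
  moreover have "[lagrangian_angle \<phi> x + real p * Arg (\<phi> x $ 1) + real q * Arg (\<phi> x $ 2) = 0]
      (rmod 2 * pi)" if "x \<in> I \<times> J" for x
    using rcong_add[OF angle[OF that] rcong_refl[of "real p * Arg (\<phi> x $ 1) + real q * Arg (\<phi> x $ 2)"]]
    by (simp add: add.assoc)
  ultimately show ?thesis
    using smooth nz unfolding lagrangian_immersion_on_def immersion_on_def by blast
qed

end
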